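(* Let $M=(E,\mathcal{I})$ be a finite matroid with base polytope $P_B$, and let $x^1,x^2,\ldots$ be the relative loads of a greedy base packing of $M$. Then the limit $x^*=\lim_{k\to\infty}x^k$ exists, and $x^*$ minimizes $\sum_{e\in E}\varphi(x_e)$ over $x\in P_B$ for every convex function $\varphi:\mathbb{R}\to\mathbb{R}$. In particular, (1) $x^*$ is the point of $P_B$ minimizing $\|x\|_2$, and (2) $x^*$ minimizes $\|x\|_p$ over $P_B$ for every $1<p<\infty$.
   Context: The base polytope $P_B\subseteq\mathbb{R}^E$ is the convex hull of the indicator vectors $\xi_B\in\{0,1\}^E$ of the bases $B$ of $M$. A greedy base packing is a sequence of bases $B_1,B_2,\ldots$ such that $B_k$ is a minimum-weight base of $M$ with respect to the weights $x^{k-1}$ (ties broken arbitrarily), where $x^0=\mathbf 0$ and $x^k=\frac1k(\xi_{B_1}+\cdots+\xi_{B_k})$ are the relative loads. *)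

theory Defs
  imports "HOL-Analysis.Analysis"
begin

locale matroid =
  fixes E :: "'a set" and \<I> :: "'a set set"
  assumes finite_ground: "finite E"
    and indep_subset_ground: "X \<in> \<I> \<Longrightarrow> X \<subseteq> E"
    and empty_indep: "{} \<in> \<I>"
    and indep_mono: "X \<in> \<I> \<Longrightarrow> Y \<subseteq> X \<Longrightarrow> Y \<in> \<I>"
    and indep_augment: "X \<in> \<I> \<Longrightarrow> Y \<in> \<I> \<Longrightarrow> card X < card Y \<Longrightarrow>
      \<exists>e \<in> Y - X. insert e X \<in> \<I>"

definition is_base :: "'a set set \<Rightarrow> 'a set \<Rightarrow> bool" where
  "is_base \<I> B \<longleftrightarrow> B \<in> \<I> \<and> (\<forall>X \<in> \<I>. B \<subseteq> X \<longrightarrow> X = B)"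

text \<open>The space of real vectors indexed by the ground set \<open>E\<close> is represented inside
  \<open>real ^ 'a\<close> by the vectors whose coordinates outside \<open>E\<close> are \<open>0\<close>. Since
  \<open>E\<close> may be any subset of the finite type \<open>'a\<close>, the empty ground set is included.\<close>

definition incidence_vec :: "'a::finite set \<Rightarrow> real ^ 'a" where
  "incidence_vec B = (\<chi> e. indicator B e)"

definition base_polytope :: "'a::finite set set \<Rightarrow> (real ^ 'a) set" where
  "base_polytope \<I> = convex hull (incidence_vec ` {B. is_base \<I> B})"

definition is_min_weight_base :: "'a::finite set set \<Rightarrow> real ^ 'a \<Rightarrow> 'a set \<Rightarrow> bool" where
  "is_min_weight_base \<I> w B \<longleftrightarrow> is_arg_min (\<lambda>A. \<Sum>e\<in>A. w $ e) (is_base \<I>) B"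

text \<open>Packings are numbered from \<open>1\<close>; the entry \<open>B 0\<close> is never used. For \<open>k = 0\<close>
  the sum is empty, so the load is \<open>0\<close>.\<close>

definition relative_load :: "(nat \<Rightarrow> 'a::finite set) \<Rightarrow> nat \<Rightarrow> real ^ 'a" where
  "relative_load B k = (1 / real k) *\<^sub>R (\<Sum>i = 1..k. incidence_vec (B i))"

definition greedy_base_packing :: "'a::finite set set \<Rightarrow> (nat \<Rightarrow> 'a set) \<Rightarrow> bool" where
  "greedy_base_packing \<I> B \<longleftrightarrow>
    (\<forall>k\<ge>1. is_min_weight_base \<I> (relative_load B (k - 1)) (B k))"

definition lp_norm :: "'a::finite set \<Rightarrow> real \<Rightarrow> real ^ 'a \<Rightarrow> real" where
  "lp_norm E p x = (\<Sum>e\<in>E. \<bar>x $ e\<bar> powr p) powr (1 / p)"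

end

theory Submission
  imports Defs
begin

text \<open>The greedy packing is the Frank--Wolfe method with step size \<open>1/k\<close> for \<open>\<parallel>x\<parallel>\<^sup>2 / 2\<close> on the
  base polytope, whose gradient at the current load is the load itself. Let \<open>x\<close> be the point of
  minimum norm and \<open>D\<^sub>k = \<xi>\<^sub>1 + \<dots> + \<xi>\<^sub>k - k x\<close>. The choice of the next base and the variational
  inequality for \<open>x\<close> both make the cross term in \<open>\<parallel>D\<^sub>k + (\<xi> - x)\<parallel>\<^sup>2\<close> nonpositive, so \<open>\<parallel>D\<^sub>k\<parallel>\<^sup>2\<close> grows
  at most linearly and \<open>D\<^sub>k / k \<longlonglongrightarrow> 0\<close>.

  By the variational inequality every base occurring in a convex representation of \<open>x\<close> has minimum
  weight for the weights \<open>x\<close>. In a matroid such a base stays of minimum weight when the weights are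
  transformed by a monotone function. Taking for this function a subgradient \<open>g\<close> of \<open>\<phi>\<close> gives
  \<open>g(x) \<bullet> (y - x) \<ge> 0\<close> on the polytope, which is the optimality condition for \<open>\<Sum> \<phi>(x\<^sub>e)\<close>.\<close>

section \<open>Convergence of greedy averages\<close>

lemma tendsto_average_if_inner_nonpos:
  fixes v :: "nat \<Rightarrow> 'v::real_inner"
  assumes greedy: "\<And>k. (\<Sum>i = 1..k. v i) \<bullet> (v (Suc k) - x) \<le> 0"
    and opt: "\<And>k. 0 \<le> x \<bullet> (v (Suc k) - x)"
    and bound: "\<And>k. norm (v (Suc k) - x) \<le> C"
  shows "(\<lambda>k. (1 / real k) *\<^sub>R (\<Sum>i = 1..k. v i)) \<longlonglongrightarrow> x"
proof -
  define D where "D k = (\<Sum>i = 1..k. v i) - real k *\<^sub>R x" for k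
  have C: "0 \<le> C" using bound[of 0] norm_ge_zero order_trans by blast
  have D_sq: "(norm (D k))\<^sup>2 \<le> real k * C\<^sup>2" for k
  proof (induction k)
    case 0
    show ?case by (simp add: D_def)
  next
    case (Suc k)
    have "(norm (d + u))\<^sup>2 = (norm d)\<^sup>2 + 2 * (d \<bullet> u) + (norm u)\<^sup>2" for d u :: 'v
      by (simp add: power2_norm_eq_inner inner_commute inner_add_left inner_add_right)
    moreover have "D (Suc k) = D k + (v (Suc k) - x)"
      by (simp add: D_def algebra_simps)
    ultimately have "(norm (D (Suc k)))\<^sup>2
        = (norm (D k))\<^sup>2 + 2 * (D k \<bullet> (v (Suc k) - x)) + (norm (v (Suc k) - x))\<^sup>2"
      by simp
    moreover have "D k \<bullet> (v (Suc k) - x) \<le> 0"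
    proof -
      have "D k \<bullet> (v (Suc k) - x)
          = (\<Sum>i = 1..k. v i) \<bullet> (v (Suc k) - x) - real k * (x \<bullet> (v (Suc k) - x))"
        unfolding D_def by (simp add: inner_diff_left)
      moreover have "0 \<le> real k * (x \<bullet> (v (Suc k) - x))"
        using opt by simp
      ultimately show ?thesis using greedy[of k] by linarith
    qed
    moreover have "(norm (v (Suc k) - x))\<^sup>2 \<le> C\<^sup>2"
      using bound by (intro power_mono) auto
    ultimately show ?case using Suc.IH by (simp add: algebra_simps)
  qed
  \<comment> \<open>At \<open>k = 0\<close> division by zero yields 0 and the bound would read
    \<open>norm x \<le> 0\<close>, hence the restriction to \<open>1 \<le> k\<close>.\<close>
  have "norm ((1 / real k) *\<^sub>R (\<Sum>i = 1..k. v i) - x) \<le> C / sqrt (real k)" if "1 \<le> k" for k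
  proof -
    have "(1 / real k) *\<^sub>R (\<Sum>i = 1..k. v i) - x = (1 / real k) *\<^sub>R D k"
      using that by (simp add: D_def scaleR_diff_right)
    moreover have "norm (D k) \<le> sqrt (real k) * C"
      using real_le_rsqrt[OF D_sq[of k]] C by (simp add: real_sqrt_mult)
    ultimately have "norm ((1 / real k) *\<^sub>R (\<Sum>i = 1..k. v i) - x) \<le> (sqrt (real k) * C) / real k"
      by (simp add: divide_right_mono)
    also have "\<dots> = C / sqrt (real k)"
      by (metis mult.commute real_div_sqrt of_nat_0_le_iff divide_divide_eq_right)
    finally show ?thesis .
  qed
  then have "\<forall>\<^sub>F k in sequentially.
      norm ((1 / real k) *\<^sub>R (\<Sum>i = 1..k. v i) - x) \<le> C / sqrt (real k)"
    by (auto simp: eventually_sequentially)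
  moreover have "(\<lambda>k. C / sqrt (real k)) \<longlonglongrightarrow> 0"
    by (intro tendsto_divide_0[OF tendsto_const] filterlim_at_top_imp_at_infinity
        filterlim_compose[OF sqrt_at_top filterlim_real_sequentially])
  ultimately have "(\<lambda>k. (1 / real k) *\<^sub>R (\<Sum>i = 1..k. v i) - x) \<longlonglongrightarrow> 0"
    by (rule Lim_null_comparison)
  then show ?thesis by (simp add: LIM_zero_iff)
qed

section \<open>Convex functions on the real line\<close>

lemma convex_subgradientE:
  fixes \<phi> :: "real \<Rightarrow> real"
  assumes "convex_on UNIV \<phi>"
  obtains g where "mono g" "\<And>x y. \<phi> x + g x * (y - x) \<le> \<phi> y"
proof -
  \<comment> \<open>This infimum of difference quotients to the right of \<open>x\<close> is the
    right derivative of \<open>\<phi>\<close>.\<close>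
  define g where "g x = Inf ((\<lambda>t. (\<phi> x - \<phi> t) / (x - t)) ` ({x<..} \<inter> UNIV))" for x
  have sub: "\<phi> x + g x * (y - x) \<le> \<phi> y" for x y
    unfolding g_def by (rule convex_le_Inf_differential[OF assms]) auto
  have "mono g"
  proof (rule monoI)
    fix x y :: real
    assume "x \<le> y"
    \<comment> \<open>Sum of the subgradient inequalities at \<open>x\<close> and at
      \<open>y\<close>.\<close>
    have "0 \<le> (g y - g x) * (y - x)"
      using sub[of x y] sub[of y x] by (simp add: algebra_simps)
    with \<open>x \<le> y\<close> show "g x \<le> g y"
      by (cases "x = y") (auto simp: zero_le_mult_iff)
  qed
  with sub that show thesis by blast
qed

text \<open>Convexity for positive arguments extends to 0 because \<open>s powr p \<le> s\<close>
  for \<open>0 < s < 1\<close>. It extends to the whole line by the triangle inequality, since the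
  power is increasing on nonnegative arguments.\<close>

lemma convex_on_abs_powr:
  fixes p :: real
  assumes "1 \<le> p"
  shows "convex_on UNIV (\<lambda>x::real. \<bar>x\<bar> powr p)"
proof (rule convex_onI)
  fix t x y :: real
  assume t: "0 < t" "t < 1"
  have shrink: "(s * c) powr p \<le> s * c powr p" if "0 < s" "s < 1" "0 \<le> c" for s c :: real
    using that assms powr_le_one_le[of s p] by (simp add: powr_mult mult_right_mono)
  have pos: "((1 - t) * a + t * b) powr p \<le> (1 - t) * a powr p + t * b powr p"
    if nonneg: "0 \<le> a" "0 \<le> b" for a b :: real
  proof -
    consider "a = 0" | "b = 0" | "0 < a" "0 < b" using nonneg by fastforce
    then show ?thesis
    proof cases
      case 1
      then show ?thesis using shrink[of t b] t nonneg by simp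
    next
      case 2
      then show ?thesis using shrink[of "1 - t" a] t nonneg by simp
    next
      case 3
      then show ?thesis
        using convex_onD[OF powr_convex[OF assms], of t a b] t by simp
    qed
  qed
  have "\<bar>(1 - t) * x + t * y\<bar> \<le> (1 - t) * \<bar>x\<bar> + t * \<bar>y\<bar>"
    using t abs_triangle_ineq[of "(1 - t) * x" "t * y"] by (simp add: abs_mult)
  then have "\<bar>(1 - t) * x + t * y\<bar> powr p \<le> ((1 - t) * \<bar>x\<bar> + t * \<bar>y\<bar>) powr p"
    using assms by (intro powr_mono2) auto
  also have "\<dots> \<le> (1 - t) * \<bar>x\<bar> powr p + t * \<bar>y\<bar> powr p"
    by (rule pos) auto
  finally show "\<bar>(1 - t) *\<^sub>R x + t *\<^sub>R y\<bar> powr p \<le> (1 - t) * \<bar>x\<bar> powr p + t * \<bar>y\<bar> powr p"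
    by simp
qed simp

section \<open>Linear functionals on a convex hull\<close>

text \<open>Since \<open>a\<close> is minimal at \<open>x\<close>, a convex representation of
  \<open>x\<close> uses only points on the face where \<open>a\<close> takes the value
  \<open>a \<bullet> x\<close>. If \<open>b\<close> is minimal at each point of that face in
  \<open>S\<close>, it is minimal at their average \<open>x\<close>.\<close>

lemma convex_hull_inner_minimal:
  fixes S :: "'v::real_inner set"
  assumes "finite S" "x \<in> convex hull S"
    and minx: "\<And>v. v \<in> S \<Longrightarrow> a \<bullet> x \<le> a \<bullet> v"
    and face: "\<And>v u. v \<in> S \<Longrightarrow> u \<in> S \<Longrightarrow> a \<bullet> v = a \<bullet> x \<Longrightarrow> b \<bullet> v \<le> b \<bullet> u"
    and "y \<in> convex hull S"
  shows "b \<bullet> x \<le> b \<bullet> y"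
proof -
  obtain c where c: "\<And>v. v \<in> S \<Longrightarrow> 0 \<le> c v" "sum c S = 1" "(\<Sum>v\<in>S. c v *\<^sub>R v) = x"
    using assms(2) by (auto simp: convex_hull_finite[OF assms(1)])
  have inner_x: "d \<bullet> x = (\<Sum>v\<in>S. c v * (d \<bullet> v))" for d
    by (simp add: inner_sum_right flip: c(3))
  \<comment> \<open>A vanishing sum of nonnegative terms: each point off the face has coefficient
    0.\<close>
  have "(\<Sum>v\<in>S. c v * (a \<bullet> v - a \<bullet> x)) = 0"
    by (simp add: right_diff_distrib sum_subtractf c(2) flip: inner_x sum_distrib_right)
  then have support: "\<forall>v\<in>S. c v * (a \<bullet> v - a \<bullet> x) = 0"
    using c(1) minx by (subst (asm) sum_nonneg_eq_0_iff) (auto simp: assms(1))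
  have "b \<bullet> x \<le> b \<bullet> u" if "u \<in> S" for u
  proof -
    have "c v * (b \<bullet> v) \<le> c v * (b \<bullet> u)" if "v \<in> S" for v
      using support c(1)[OF that] face[OF that \<open>u \<in> S\<close>] that
      by (cases "c v = 0") (auto intro: mult_left_mono)
    then have "b \<bullet> x \<le> (\<Sum>v\<in>S. c v * (b \<bullet> u))"
      unfolding inner_x by (rule sum_mono)
    then show ?thesis using c(2) by (simp flip: sum_distrib_right)
  qed
  then have "S \<subseteq> {z. b \<bullet> x \<le> b \<bullet> z}" by auto
  moreover have "convex {z. b \<bullet> x \<le> b \<bullet> z}"
    using convex_halfspace_ge[of "b \<bullet> x" b] by simp
  ultimately have "convex hull S \<subseteq> {z. b \<bullet> x \<le> b \<bullet> z}" by (rule hull_minimal)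
  with assms(5) show ?thesis by auto
qed

section \<open>Comparing sums through sublevel counts\<close>

text \<open>The counts say that the i-th smallest weight in \<open>B\<close> is at most the i-th
  smallest in \<open>A\<close>, so the sums compare term by term. The induction removes a heaviest
  element from each side.\<close>

lemma sum_mono_comp_le_if_card_sublevel_le:
  fixes w :: "'a \<Rightarrow> real" and g :: "real \<Rightarrow> real"
  assumes "finite A" "finite B" "card A = card B" "mono g"
    and "\<And>t. card {e \<in> A. w e \<le> t} \<le> card {e \<in> B. w e \<le> t}"
  shows "(\<Sum>e\<in>B. g (w e)) \<le> (\<Sum>e\<in>A. g (w e))"
  using assms
proof (induction "card A" arbitrary: A B)
  case 0
  then show ?case by simp
next
  case (Suc n)
  then have ne: "A \<noteq> {}" "B \<noteq> {}" by auto
  obtain a where a: "a \<in> A" "\<And>e. e \<in> A \<Longrightarrow> w e \<le> w a"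
    using Max_in[of "w ` A"] Max_ge[of "w ` A"] Suc.prems(1) ne(1) by fastforce
  obtain b where b: "b \<in> B" "\<And>e. e \<in> B \<Longrightarrow> w e \<le> w b"
    using Max_in[of "w ` B"] Max_ge[of "w ` B"] Suc.prems(2) ne(2) by fastforce
  \<comment> \<open>At level \<open>w a\<close> all of \<open>A\<close> is counted, so equal
    cardinality forces all of \<open>B\<close> to be counted.\<close>
  have "{e \<in> B. w e \<le> w a} = B"
  proof (rule card_seteq)
    have "{e \<in> A. w e \<le> w a} = A" using a(2) by auto
    then show "card B \<le> card {e \<in> B. w e \<le> w a}"
      using Suc.prems(3) Suc.prems(5)[of "w a"] by simp
  qed (use Suc.prems(2) in auto)
  then have ba: "w b \<le> w a" using b(1) by blast
  \<comment> \<open>From level \<open>w b\<close> on, all of \<open>B - {b}\<close> is counted;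
    below it neither \<open>a\<close> nor \<open>b\<close> was counted before the removal.\<close>
  have "card {e \<in> A - {a}. w e \<le> t} \<le> card {e \<in> B - {b}. w e \<le> t}" for t
  proof (cases "w b \<le> t")
    case True
    have "{e \<in> B - {b}. w e \<le> t} = B - {b}"
      using True b(2) by force
    moreover have "card {e \<in> A - {a}. w e \<le> t} \<le> card (A - {a})"
      using Suc.prems(1) by (intro card_mono) auto
    ultimately show ?thesis
      using a(1) b(1) Suc.prems(1-3) by simp
  next
    case False
    then have "{e \<in> A - {a}. w e \<le> t} = {e \<in> A. w e \<le> t}"
      "{e \<in> B - {b}. w e \<le> t} = {e \<in> B. w e \<le> t}"
      using ba by auto
    then show ?thesis using Suc.prems(5) by simp
  qed
  then have "(\<Sum>e\<in>B - {b}. g (w e)) \<le> (\<Sum>e\<in>A - {a}. g (w e))"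
    using Suc.hyps(2) Suc.prems a(1) b(1) by (intro Suc.hyps(1)) auto
  moreover have "g (w b) \<le> g (w a)" using ba Suc.prems(4) by (auto dest: monoD)
  ultimately show ?case
    using a(1) b(1) Suc.prems(1,2) by (simp add: sum.remove)
qed

section \<open>Bases of a matroid\<close>

context matroid
begin

lemma finite_indep: "X \<in> \<I> \<Longrightarrow> finite X"
  using indep_subset_ground finite_ground finite_subset by blast

lemma card_indep_le_base:
  assumes "is_base \<I> B" "X \<in> \<I>"
  shows "card X \<le> card B"
proof (rule ccontr)
  assume "\<not> card X \<le> card B"
  then obtain e where "e \<in> X - B" "insert e B \<in> \<I>"
    using indep_augment[of B X] assms by (auto simp: is_base_def)
  then show False using assms(1) by (auto simp: is_base_def)
qed

lemma card_base_eq: "is_base \<I> A \<Longrightarrow> is_base \<I> B \<Longrightarrow> card A = card B"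
  by (meson card_indep_le_base is_base_def le_antisym)

lemma is_base_if_card_eq:
  assumes "is_base \<I> B" "X \<in> \<I>" "card X = card B"
  shows "is_base \<I> X"
  unfolding is_base_def
proof (intro conjI ballI impI)
  fix Y
  assume "Y \<in> \<I>" "X \<subseteq> Y"
  then show "Y = X"
    using card_seteq[of Y X] card_indep_le_base[OF assms(1), of Y] assms(3) finite_indep by auto
qed (rule assms(2))

lemma extend_indep_in_base:
  assumes "is_base \<I> B" "X \<in> \<I>"
  obtains Y where "X \<subseteq> Y" "Y \<subseteq> X \<union> B" "is_base \<I> Y"
proof -
  have "\<exists>Y. X \<subseteq> Y \<and> Y \<subseteq> X \<union> B \<and> is_base \<I> Y"
    using assms(2)
  proof (induction "card B - card X" arbitrary: X)
    \<comment> \<open>Truncated subtraction gives only \<open>card B \<le> card X\<close> here;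
      \<open>card_indep_le_base\<close> supplies the converse.\<close>
    case 0
    then show ?case
      using is_base_if_card_eq[OF assms(1), of X] card_indep_le_base[OF assms(1), of X] by auto
  next
    case (Suc n)
    then have "card X < card B" by linarith
    moreover have "B \<in> \<I>" using assms(1) by (simp add: is_base_def)
    ultimately obtain e where e: "e \<in> B - X" "insert e X \<in> \<I>"
      using indep_augment[OF Suc.prems] by blast
    then have "n = card B - card (insert e X)"
      using Suc.hyps(2) Suc.prems finite_indep by simp
    then show ?case using Suc.hyps(1)[OF _ e(2)] e(1) by blast
  qed
  with that show thesis by blast
qed

text \<open>If \<open>B\<close> were not of maximum cardinality below level \<open>t\<close>, it could exchange an element of weight
  above \<open>t\<close> for one of weight at most \<open>t\<close>.\<close>

lemma card_sublevel_le_min_base: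
  fixes w :: "'a \<Rightarrow> real"
  assumes base: "is_base \<I> B"
    and min: "\<And>A. is_base \<I> A \<Longrightarrow> (\<Sum>e\<in>B. w e) \<le> (\<Sum>e\<in>A. w e)"
    and "A \<in> \<I>"
  shows "card {e \<in> A. w e \<le> t} \<le> card {e \<in> B. w e \<le> t}"
proof (rule ccontr)
  assume less: "\<not> ?thesis"
  have B: "B \<in> \<I>" using base by (simp add: is_base_def)
  obtain e where e: "e \<in> A" "w e \<le> t" "e \<notin> B" and
    ind: "insert e {e \<in> B. w e \<le> t} \<in> \<I>"
    using indep_augment[of "{e \<in> B. w e \<le> t}" "{e \<in> A. w e \<le> t}"] less
      indep_mono[OF B] indep_mono[OF \<open>A \<in> \<I>\<close>] by auto
  \<comment> \<open>\<open>Y\<close> keeps the whole part of \<open>B\<close> of weight at most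
    \<open>t\<close>, so any element of \<open>B\<close> missing from \<open>Y\<close> has weight
    above \<open>t\<close>.\<close>
  obtain Y where Y: "insert e {e \<in> B. w e \<le> t} \<subseteq> Y" "Y \<subseteq> insert e {e \<in> B. w e \<le> t} \<union> B"
    "is_base \<I> Y"
    using extend_indep_in_base[OF base ind] .
  have fin: "finite B" "finite Y" using B Y(3) finite_indep by (auto simp: is_base_def)
  have "card (Y - {e}) < card B"
    using Y(1) fin(2) card_base_eq[OF Y(3) base] card_Diff1_less[of Y e] by simp
  then have "\<not> B \<subseteq> Y - {e}"
    using card_mono[of "Y - {e}" B] fin(2) by auto
  then obtain f where f: "f \<in> B" "f \<notin> Y" using e(3) by blast
  \<comment> \<open>Equal cardinality of bases leaves room for only one missing element, so
    \<open>Y\<close> arises from \<open>B\<close> by a single exchange.\<close>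
  have "Y = insert e (B - {f})"
  proof (rule card_subset_eq)
    show "Y \<subseteq> insert e (B - {f})" using Y(2) f by auto
    show "card Y = card (insert e (B - {f}))"
      using e(3) f(1) fin card_base_eq[OF Y(3) base] card_gt_0_iff[of B] by auto
  qed (use fin in auto)
  then have "(\<Sum>e\<in>Y. w e) = w e + (\<Sum>e\<in>B. w e) - w f"
    using e(3) f(1) fin by (simp add: sum_diff1)
  moreover have "w e < w f" using Y(1) e(2) f by auto
  ultimately show False using min[OF Y(3)] by simp
qed

text \<open>A minimum-weight base is at least as numerous as any other base in every sublevel set of
  \<open>w\<close>, and this comparison of counts carries over to sums of any monotone
  \<open>g\<close>.\<close>

lemma min_base_mono_comp:
  fixes w :: "'a \<Rightarrow> real" and g :: "real \<Rightarrow> real"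
  assumes "is_base \<I> B" "\<And>A. is_base \<I> A \<Longrightarrow> (\<Sum>e\<in>B. w e) \<le> (\<Sum>e\<in>A. w e)"
    and "mono g" "is_base \<I> A"
  shows "(\<Sum>e\<in>B. g (w e)) \<le> (\<Sum>e\<in>A. g (w e))"
proof (rule sum_mono_comp_le_if_card_sublevel_le[where w = w and g = g])
  show "card {e \<in> A. w e \<le> t} \<le> card {e \<in> B. w e \<le> t}" for t
    using assms(4) by (intro card_sublevel_le_min_base[OF assms(1,2)]) (auto simp: is_base_def)
  show "finite A" "finite B"
    using assms(1,4) finite_indep by (auto simp: is_base_def)
qed (fact assms(3) card_base_eq[OF assms(4,1)])+

end

section \<open>The base polytope\<close>

lemma inner_incidence_vec:
  fixes w :: "real ^ 'a::finite"
  shows "w \<bullet> incidence_vec B = (\<Sum>e\<in>B. w $ e)"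
  unfolding inner_vec_def incidence_vec_def
  by (intro sum.mono_neutral_cong_right) auto

text \<open>Lets inner products, which sum over the whole type, be written as sums over
  \<open>E\<close>.\<close>

lemma base_polytope_nth_eq_0:
  assumes "matroid E \<I>" "x \<in> base_polytope \<I>" "e \<notin> E"
  shows "x $ e = 0"
proof -
  have "e \<notin> A" if "is_base \<I> A" for A
    using matroid.indep_subset_ground[OF assms(1), of A] that assms(3) by (auto simp: is_base_def)
  then have "incidence_vec ` {B. is_base \<I> B} \<subseteq> {x. x $ e = 0}"
    by (auto simp: incidence_vec_def)
  moreover have "convex {x :: real ^ 'a. x $ e = 0}"
    by (auto simp: convex_def)
  ultimately have "base_polytope \<I> \<subseteq> {x. x $ e = 0}"
    unfolding base_polytope_def by (rule hull_minimal)
  with assms(2) show ?thesis by auto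
qed

lemma base_polytope_convex_sum_le:
  fixes x :: "real ^ 'a::finite"
  assumes M: "matroid E \<I>" and x: "x \<in> base_polytope \<I>"
    and opt: "\<And>y. y \<in> base_polytope \<I> \<Longrightarrow> x \<bullet> x \<le> x \<bullet> y"
    and "convex_on UNIV \<phi>" and y: "y \<in> base_polytope \<I>"
  shows "(\<Sum>e\<in>E. \<phi> (x $ e)) \<le> (\<Sum>e\<in>E. \<phi> (y $ e))"
proof -
  interpret matroid E \<I> by (rule M)
  obtain g where g: "mono g" "\<And>s t. \<phi> s + g s * (t - s) \<le> \<phi> t"
    by (rule convex_subgradientE[OF assms(4)]) blast
  \<comment> \<open>On \<open>E\<close> this is a subgradient of the separable sum at
    \<open>x\<close>. Outside \<open>E\<close> its entries are \<open>g 0\<close>, harmless because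
    \<open>y - x\<close> vanishes there.\<close>
  define c :: "real ^ 'a" where "c = (\<chi> e. g (x $ e))"
  have vertex: "incidence_vec A \<in> base_polytope \<I>" if "is_base \<I> A" for A
    using that unfolding base_polytope_def by (intro hull_inc) auto
  have "c \<bullet> x \<le> c \<bullet> y"
  proof (rule convex_hull_inner_minimal)
    show "x \<in> convex hull (incidence_vec ` {B. is_base \<I> B})"
      "y \<in> convex hull (incidence_vec ` {B. is_base \<I> B})"
      using x y by (simp_all add: base_polytope_def)
    show "x \<bullet> x \<le> x \<bullet> v" if "v \<in> incidence_vec ` {B. is_base \<I> B}" for v
      using that vertex opt by auto
  next
    fix v u
    assume vu: "v \<in> incidence_vec ` {B. is_base \<I> B}" "u \<in> incidence_vec ` {B. is_base \<I> B}"
      and eq: "x \<bullet> v = x \<bullet> x"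
    then obtain A C where A: "is_base \<I> A" "v = incidence_vec A"
      and C: "is_base \<I> C" "u = incidence_vec C" by auto
    \<comment> \<open>Lying on the face means that \<open>A\<close> has minimum weight for the
      weights \<open>x\<close>.\<close>
    have "(\<Sum>e\<in>A. x $ e) \<le> (\<Sum>e\<in>A'. x $ e)" if "is_base \<I> A'" for A'
      using opt[OF vertex[OF that]] eq A(2) by (simp add: inner_incidence_vec)
    then have "(\<Sum>e\<in>A. g (x $ e)) \<le> (\<Sum>e\<in>C. g (x $ e))"
      by (rule min_base_mono_comp[OF A(1) _ g(1) C(1)])
    then show "c \<bullet> v \<le> c \<bullet> u"
      by (simp add: A(2) C(2) inner_incidence_vec c_def)
  qed simp
  then have "0 \<le> c \<bullet> (y - x)" by (simp add: inner_diff_right)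
  also have "c \<bullet> (y - x) = (\<Sum>e\<in>E. g (x $ e) * (y $ e - x $ e))"
    unfolding inner_vec_def c_def
    using base_polytope_nth_eq_0[OF M x] base_polytope_nth_eq_0[OF M y]
    by (intro sum.mono_neutral_cong_right) auto
  also have "\<dots> \<le> (\<Sum>e\<in>E. \<phi> (y $ e) - \<phi> (x $ e))"
    using g(2) by (intro sum_mono) (simp add: le_diff_eq add.commute)
  finally show ?thesis by (simp add: sum_subtractf)
qed

section \<open>Convergence and optimality of the loads\<close>

theorem theorem5:
  fixes E :: "'a::finite set" and \<I> :: "'a set set" and B :: "nat \<Rightarrow> 'a set"
  assumes "matroid E \<I>"
    and "greedy_base_packing \<I> B"
  shows "\<exists>xstar :: real ^ 'a.
    relative_load B \<longlonglongrightarrow> xstar \<and>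
    (\<forall>\<phi> :: real \<Rightarrow> real. convex_on UNIV \<phi> \<longrightarrow>
      is_arg_min (\<lambda>x. \<Sum>e\<in>E. \<phi> (x $ e)) (\<lambda>x. x \<in> base_polytope \<I>) xstar) \<and>
    (\<forall>y. is_arg_min norm (\<lambda>x. x \<in> base_polytope \<I>) y \<longleftrightarrow> y = xstar) \<and>
    (\<forall>p :: real. 1 < p \<longrightarrow>
      is_arg_min (lp_norm E p) (\<lambda>x. x \<in> base_polytope \<I>) xstar)"
proof -
  let ?P = "base_polytope \<I>" and ?V = "incidence_vec ` {B. is_base \<I> B}"
  have greedy: "is_min_weight_base \<I> (relative_load B k) (B (Suc k))" for k
    using assms(2) by (auto simp: greedy_base_packing_def dest: spec[of _ "Suc k"])
  have base: "is_base \<I> (B (Suc k))" for k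
    using greedy[of k] by (simp add: is_min_weight_base_def is_arg_min_def)
  have vertex: "incidence_vec A \<in> ?P" if "is_base \<I> A" for A
    using that unfolding base_polytope_def by (intro hull_inc) auto
  have "compact ?P"
    unfolding base_polytope_def by (intro finite_imp_compact_convex_hull) simp
  then have closed: "closed ?P" by (rule compact_imp_closed)
  have convex: "convex ?P" by (simp add: base_polytope_def)
  define x where "x = closest_point ?P 0"
  \<comment> \<open>The bases of the packing witness that the polytope is nonempty.\<close>
  have x: "x \<in> ?P"
    unfolding x_def using closed vertex[OF base] by (intro closest_point_in_set) auto
  have opt: "x \<bullet> x \<le> x \<bullet> y" if "y \<in> ?P" for y
    using closest_point_dot[OF convex closed that, of 0]
    by (simp add: x_def inner_diff_right)

  have "relative_load B \<longlonglongrightarrow> x"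
  proof -
    obtain C where C: "\<And>v. v \<in> ?V \<Longrightarrow> norm (v - x) \<le> C"
      using finite_imp_bounded[of "(\<lambda>v. v - x) ` ?V"] by (auto simp: bounded_iff)
    \<comment> \<open>Minimality among bases extends to the hull and so to its point
      \<open>x\<close>. Passing from the average to the sum only rescales by \<open>k\<close>; for
      \<open>k = 0\<close> the sum is empty.\<close>
    have "(\<Sum>i = 1..k. incidence_vec (B i)) \<bullet> (incidence_vec (B (Suc k)) - x) \<le> 0" for k
    proof -
      have "?V \<subseteq> {z. relative_load B k \<bullet> incidence_vec (B (Suc k)) \<le> relative_load B k \<bullet> z}"
        using greedy[of k]
        by (auto simp: is_min_weight_base_def is_arg_min_linorder inner_incidence_vec)
      moreover have "convex {z. relative_load B k \<bullet> incidence_vec (B (Suc k)) \<le> relative_load B k \<bullet> z}"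
        using convex_halfspace_ge by blast
      ultimately have "relative_load B k \<bullet> incidence_vec (B (Suc k)) \<le> relative_load B k \<bullet> x"
        using x hull_minimal unfolding base_polytope_def by blast
      then have "relative_load B k \<bullet> (incidence_vec (B (Suc k)) - x) \<le> 0"
        by (simp add: inner_diff_right)
      then show ?thesis
        by (cases "k = 0") (simp_all add: relative_load_def divide_le_0_iff)
    qed
    then show ?thesis
      unfolding relative_load_def
      using opt[OF vertex[OF base]] C base
      by (intro tendsto_average_if_inner_nonpos[where C = C]) (auto simp: inner_diff_right)
  qed
  moreover have conv: "is_arg_min (\<lambda>x. \<Sum>e\<in>E. \<phi> (x $ e)) (\<lambda>x. x \<in> ?P) x"
    if "convex_on UNIV \<phi>" for \<phi>
    using base_polytope_convex_sum_le[OF assms(1) x opt that] x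
    by (simp add: is_arg_min_linorder)
  moreover have "is_arg_min norm (\<lambda>x. x \<in> ?P) y \<longleftrightarrow> y = x" for y
  proof
    assume "is_arg_min norm (\<lambda>x. x \<in> ?P) y"
    then show "y = x"
      unfolding x_def using closest_point_unique[OF convex closed, of y 0]
      by (simp add: is_arg_min_linorder)
  next
    assume "y = x"
    then show "is_arg_min norm (\<lambda>x. x \<in> ?P) y"
      using x closest_point_le[OF closed, of _ 0] by (auto simp: x_def is_arg_min_linorder)
  qed
  moreover have "is_arg_min (lp_norm E p) (\<lambda>x. x \<in> ?P) x" if "1 < p" for p
  proof -
    \<comment> \<open>The outer root is increasing on nonnegative sums, so the convex case for
      \<open>\<bar>t\<bar> powr p\<close> applies.\<close>
    have "lp_norm E p x \<le> lp_norm E p y" if "y \<in> ?P" for y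
      unfolding lp_norm_def
      using \<open>1 < p\<close> that base_polytope_convex_sum_le[OF assms(1) x opt convex_on_abs_powr[of p]]
      by (intro powr_mono2) (auto intro: sum_nonneg)
    with x show ?thesis by (simp add: is_arg_min_linorder)
  qed
  ultimately show ?thesis by (intro exI[of _ x] conjI allI impI)
qed

end
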